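(* Suppose $r$ and $s$ are two positive integers, $a_{j}$ $(1\leq j\leq r)$ and $b_{k}$ $(1\leq k\leq s)$ are $r+s$ positive numbers, and $\alpha>0$, $0<q<2^{-\frac{1}{\alpha}}$. Then there exists a positive integer $K_{0}$ such that for all integers $K\geq K_{0}$, the function $$\sum_{k=K}^{\infty}\frac{(a_{1})_{k}(a_{2})_{k}\cdots (a_{r})_{k}}{(b_{1})_{k}(b_{2})_{k}\cdots (b_{s})_{k}}q^{\alpha k^2}z^k$$ has only infinitely many real zeros and all of them are negative.
   Context: Here $z$ is a complex variable, and $(a)_{k}$ is defined by $(a)_{0}=1$, $(a)_{k}=a(a+1)\cdots(a+k-1)$ for $k\geq 1$. The phrase "has only infinitely many real zeros" means that the function has infinitely many zeros and all of its zeros are real.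
   Formalization: Since every term with k ≥ K ≥ 1 contains z^K, z = 0 is always a zero of the function, so "all of them are negative" is asserted for all zeros other than this trivial zero at the origin. *)

theory Defs
  imports Complex_Main
begin

definition hyp_coeff ::
  "nat \<Rightarrow> nat \<Rightarrow> (nat \<Rightarrow> real) \<Rightarrow> (nat \<Rightarrow> real) \<Rightarrow> real \<Rightarrow> real \<Rightarrow> nat \<Rightarrow> real" where
  "hyp_coeff r s a b \<alpha> q k =
     (\<Prod>j=1..r. pochhammer (a j) k) / (\<Prod>j=1..s. pochhammer (b j) k)
       * q powr (\<alpha> * real k ^ 2)"

text \<open>The sum over all indices \<open>k \<ge> K\<close>, reindexed by \<open>k = n + K\<close>.
  The lemma \<open>summable_hyp_tail\<close> below shows that it converges for every \<open>z\<close>.\<close>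

definition hyp_tail ::
  "nat \<Rightarrow> nat \<Rightarrow> (nat \<Rightarrow> real) \<Rightarrow> (nat \<Rightarrow> real) \<Rightarrow> real \<Rightarrow> real \<Rightarrow> nat \<Rightarrow> complex \<Rightarrow> complex" where
  "hyp_tail r s a b \<alpha> q K z =
     (\<Sum>n. complex_of_real (hyp_coeff r s a b \<alpha> q (n + K)) * z ^ (n + K))"

definition only_infinitely_many_real_zeros :: "(complex \<Rightarrow> complex) \<Rightarrow> bool" where
  "only_infinitely_many_real_zeros f \<longleftrightarrow>
     infinite {z. f z = 0} \<and> (\<forall>z. f z = 0 \<longrightarrow> z \<in> \<real>)"

text \<open>For \<open>K \<ge> 1\<close> every term of the tail carries the factor \<open>z ^ K\<close>, so the origin is always a zero.
  Hence the assertion that the zeros are negative has to exclude this trivial zero.\<close>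

lemma hyp_tail_0: "K \<ge> 1 \<Longrightarrow> hyp_tail r s a b \<alpha> q K 0 = 0"
  by (simp add: hyp_tail_def power_0_left)

lemma hyp_coeff_Suc:
  "hyp_coeff r s a b \<alpha> q (Suc k) =
     hyp_coeff r s a b \<alpha> q k *
       ((\<Prod>j=1..r. a j + real k) / (\<Prod>j=1..s. b j + real k) * q powr (\<alpha> * (2 * real k + 1)))"
proof -
  have e: "\<alpha> * real (Suc k) ^ 2 = \<alpha> * real k ^ 2 + \<alpha> * (2 * real k + 1)"
    by (simp add: power2_eq_square algebra_simps)
  show ?thesis
    unfolding hyp_coeff_def e powr_add by (simp add: pochhammer_Suc prod.distrib)
qed

lemma tendsto_shifted_prod_powr:
  fixes c :: "nat \<Rightarrow> real"
  assumes "finite J" "0 < p" "p < 1"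
  shows "(\<lambda>k. (\<Prod>j\<in>J. c j + real k) * p ^ k) \<longlonglongrightarrow> 0"
  using assms
proof (induction J arbitrary: p rule: finite_induct)
  case empty
  then show ?case by (simp add: LIMSEQ_realpow_zero)
next
  case (insert i J)
  define t where "t = sqrt p"
  have t: "0 < t" "t < 1" "p = t * t"
    using insert.prems by (auto simp: t_def)
  have A: "(\<lambda>k. (c i + real k) * t ^ k) \<longlonglongrightarrow> 0"
  proof -
    have 1: "(\<lambda>k. c i * t ^ k) \<longlonglongrightarrow> 0"
      using t by (intro tendsto_mult_right_zero LIMSEQ_realpow_zero) auto
    have 2: "(\<lambda>k. real k * t ^ k) \<longlonglongrightarrow> 0"
      using powser_times_n_limit_0[of t] t by simp
    show ?thesis using tendsto_add[OF 1 2] by (simp add: algebra_simps)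
  qed
  have B: "(\<lambda>k. (\<Prod>j\<in>J. c j + real k) * t ^ k) \<longlonglongrightarrow> 0"
    using insert.IH t by blast
  show ?case
    using tendsto_mult[OF A B] insert.hyps
    by (simp add: t(3) power_mult_distrib mult_ac)
qed

lemma summable_hyp_tail:
  fixes z :: complex
  assumes b: "\<And>j. j \<in> {1..s} \<Longrightarrow> b j > 0" and \<alpha>: "\<alpha> > 0" and q: "0 < q" "q < 1"
  shows "summable (\<lambda>n. complex_of_real (hyp_coeff r s a b \<alpha> q (n + K)) * z ^ (n + K))"
proof -
  let ?u = "\<lambda>k. complex_of_real (hyp_coeff r s a b \<alpha> q k) * z ^ k"
  define p where "p = q powr (2 * \<alpha>)"
  have p: "0 < p" "p < 1"
    using \<alpha> q powr_less_mono2[of "2 * \<alpha>" q 1] by (auto simp: p_def)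
  let ?R = "\<lambda>k. (\<Prod>j=1..r. a j + real k) / (\<Prod>j=1..s. b j + real k)
                  * q powr (\<alpha> * (2 * real k + 1))"
  have pk: "q powr (\<alpha> * (2 * real k + 1)) = q powr \<alpha> * p ^ k" for k
  proof -
    have "\<alpha> * (2 * real k + 1) = \<alpha> + (2 * \<alpha>) * real k" by (simp add: algebra_simps)
    then show ?thesis
      using q p by (simp add: powr_add p_def powr_powr [symmetric] powr_realpow)
  qed
  have lim: "(\<lambda>k. norm z * q powr \<alpha> * \<bar>(\<Prod>j=1..r. a j + real k) * p ^ k\<bar>) \<longlonglongrightarrow> 0"
    by (intro tendsto_mult_right_zero tendsto_rabs_zero tendsto_shifted_prod_powr p) simp
  have "eventually (\<lambda>k. norm z * q powr \<alpha> * \<bar>(\<Prod>j=1..r. a j + real k) * p ^ k\<bar> < 1/2) sequentially"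
    using order_tendstoD(2)[OF lim, of "1/2"] by simp
  then obtain N where
    N: "\<And>k. k \<ge> N \<Longrightarrow> norm z * q powr \<alpha> * \<bar>(\<Prod>j=1..r. a j + real k) * p ^ k\<bar> < 1/2"
    by (auto simp: eventually_sequentially)
  have "summable ?u"
  proof (rule summable_ratio_test [where c = "1/2" and N = "max N 1"])
    fix k assume k: "k \<ge> max N 1"
    have D: "(\<Prod>j=1..s. b j + real k) \<ge> 1"
      by (rule prod_ge_1) (use b k in \<open>force dest: b\<close>)
    have "\<bar>?R k\<bar> * norm z =
        (norm z * q powr \<alpha> * \<bar>(\<Prod>j=1..r. a j + real k) * p ^ k\<bar>) / (\<Prod>j=1..s. b j + real k)"
      using D p unfolding pk by (simp add: abs_mult mult_ac)
    also have "\<dots> \<le> norm z * q powr \<alpha> * \<bar>(\<Prod>j=1..r. a j + real k) * p ^ k\<bar>"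
      using D divide_left_mono[OF D, of "norm z * q powr \<alpha> * \<bar>(\<Prod>j=1..r. a j + real k) * p ^ k\<bar>"] by simp
    also have "\<dots> \<le> 1/2" using N[of k] k by simp
    finally have R: "\<bar>?R k\<bar> * norm z \<le> 1/2" .
    have "norm (?u (Suc k)) = (\<bar>?R k\<bar> * norm z) * norm (?u k)"
      by (simp only: hyp_coeff_Suc norm_mult norm_of_real abs_mult power_Suc mult_ac)
    also have "\<dots> \<le> 1/2 * norm (?u k)"
      by (intro mult_right_mono R) simp
    finally show "norm (?u (Suc k)) \<le> 1/2 * norm (?u k)" .
  qed simp
  then show ?thesis by (rule summable_ignore_initial_segment)
qed

end

theory Submission
  imports Defs "HOL-Complex_Analysis.Great_Picard" "HOL-Real_Asymp.Real_Asymp"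
begin

text \<open>Since \<open>q powr \<alpha> < 1/2\<close> and the quotient of Pochhammer products varies slowly, the coefficients
  eventually satisfy Hutchinson's condition \<open>c\<^sub>n\<^sub>+\<^sub>1\<^sup>2 > 4 c\<^sub>n c\<^sub>n\<^sub>+\<^sub>2\<close>. For such a sequence, at a suitable negative
  point a single term dominates its two neighbours by AM-GM, and the remaining terms form alternating
  monotone sums, so the sign of the power series and of its partial sums at that point is the sign of
  the dominant term. Hence the partial sum of degree \<open>n\<close> has \<open>n\<close> distinct negative zeros, which are all
  of its zeros; Hurwitz's theorem on the plane slit along the nonpositive reals passes this to the
  limit, while the intermediate value theorem applied to the limit gives infinitely many zeros.\<close>

section \<open>Alternating sums\<close>

text \<open>Signed by its last term, each sum is the new term minus the previous signed sum. Growth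
  of the terms keeps this difference between 0 and the last term.\<close>

lemma alternating_sum_increasing:
  fixes t :: "nat \<Rightarrow> real"
  assumes "0 \<le> t 0" and "\<And>k. k < p \<Longrightarrow> t k \<le> t (Suc k)"
  shows "(-1) ^ p * (\<Sum>k\<le>p. (-1) ^ k * t k) \<in> {0..t p}"
  using assms
proof (induction p)
  case (Suc p)
  have "(-1) ^ Suc p * (\<Sum>k\<le>Suc p. (-1) ^ k * t k)
      = t (Suc p) - (-1) ^ p * (\<Sum>k\<le>p. (-1) ^ k * t k)"
    by (simp add: algebra_simps flip: power_add mult.assoc mult_2)
  moreover have "(-1) ^ p * (\<Sum>k\<le>p. (-1) ^ k * t k) \<in> {0..t p}"
    using Suc by simp
  moreover have "t p \<le> t (Suc p)"
    using Suc.prems by simp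
  ultimately show ?case by auto
qed simp

text \<open>Here the induction peels off the first term and shifts the sequence, so \<open>t\<close>
  has to be arbitrary.\<close>

lemma alternating_sum_decreasing:
  fixes t :: "nat \<Rightarrow> real"
  assumes "\<And>k. 0 \<le> t k" and "\<And>k. t (Suc k) \<le> t k"
  shows "(\<Sum>k\<le>n. (-1) ^ k * t k) \<in> {0..t 0}"
  using assms
proof (induction n arbitrary: t)
  case (Suc n)
  have "(\<Sum>k\<le>Suc n. (-1) ^ k * t k) = t 0 - (\<Sum>k\<le>n. (-1) ^ k * t (Suc k))"
    by (simp add: sum.atMost_Suc_shift sum_negf del: sum.atMost_Suc)
  moreover have "(\<Sum>k\<le>n. (-1) ^ k * t (Suc k)) \<in> {0..t (Suc 0)}"
    using Suc.IH[of "\<lambda>k. t (Suc k)"] Suc.prems by simp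
  moreover have "t (Suc 0) \<le> t 0"
    using Suc.prems by simp
  ultimately show ?case by auto
qed simp

text \<open>The block up to \<open>p\<close> and the block from \<open>p + 2\<close> on oppose the
  term of index \<open>p + 1\<close> by at most \<open>t p\<close> and \<open>t (p + 2)\<close>, so
  \<open>dom\<close> leaves that term in control. The bound does not depend on
  \<open>n\<close>.\<close>

lemma alternating_sum_dominant_term:
  fixes t :: "nat \<Rightarrow> real"
  assumes nonneg: "\<And>k. 0 \<le> t k"
    and inc: "\<And>k. k < p \<Longrightarrow> t k \<le> t (Suc k)"
    and dec: "\<And>k. Suc p < k \<Longrightarrow> t (Suc k) \<le> t k"
    and dom: "t p + t (p + 2) < t (Suc p)"
    and n: "Suc p \<le> n"
  shows "(-1) ^ Suc p * (\<Sum>k\<le>n. (-1) ^ k * t k) > 0"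
proof -
  let ?g = "\<lambda>k. (-1) ^ k * t k"
  have A: "(-1) ^ p * (\<Sum>k\<le>p. ?g k) \<le> t p"
    using alternating_sum_increasing[of t p] nonneg inc by simp
  have sgn: "(-1) ^ Suc p * ?g (Suc p) = t (Suc p)"
    by (simp flip: power_add mult.assoc mult_2)
  show ?thesis
  proof (cases "n = Suc p")
    case True
    have "(-1) ^ Suc p * (\<Sum>k\<le>n. ?g k) = t (Suc p) - (-1) ^ p * (\<Sum>k\<le>p. ?g k)"
      using sgn True by (simp add: algebra_simps)
    then show ?thesis
      using A dom nonneg[of "p + 2"] by linarith
  next
    case False
    then obtain l where l: "n = p + 2 + l"
      using n by (metis add_2_eq_Suc' le_Suc_ex le_neq_implies_less Suc_leI)
    have split: "(\<Sum>k\<le>p + 2 + l. ?g k) = (\<Sum>k\<le>p. ?g k) + ?g (Suc p) + (\<Sum>j\<le>l. ?g (p + 2 + j))"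
      by (induction l) simp_all
    have B: "(\<Sum>j\<le>l. (-1) ^ j * t (p + 2 + j)) \<le> t (p + 2)"
      using alternating_sum_decreasing[of "\<lambda>j. t (p + 2 + j)" l] nonneg dec by simp
    have tail: "(-1) ^ Suc p * (\<Sum>j\<le>l. ?g (p + 2 + j)) = - (\<Sum>j\<le>l. (-1) ^ j * t (p + 2 + j))"
      by (simp add: sum_distrib_left power_add sum_negf flip: mult.assoc)
    have "(-1) ^ Suc p * (\<Sum>k\<le>n. ?g k)
        = t (Suc p) - (-1) ^ p * (\<Sum>k\<le>p. ?g k) - (\<Sum>j\<le>l. (-1) ^ j * t (p + 2 + j))"
      unfolding l split distrib_left sgn tail by simp
    then show ?thesis
      using A B dom by linarith
  qed
qed

section \<open>Coefficient sequences satisfying Hutchinson's condition\<close>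

locale Hutchinson_sequence =
  fixes c :: "nat \<Rightarrow> real"
  assumes pos: "c n > 0"
    and hutchinson: "4 * c n * c (n + 2) < c (Suc n) ^ 2"
begin

text \<open>This is the absolute value of the argument at which the terms of index \<open>k\<close>
  and \<open>k + 1\<close> have equal size.\<close>

definition ratio :: "nat \<Rightarrow> real" where
  "ratio k = c k / c (Suc k)"

text \<open>At \<open>x = -sep (Suc p)\<close> the terms of index \<open>p\<close> and \<open>p + 2\<close> have equal absolute value, and the
  condition says precisely that the term of index \<open>p + 1\<close> dominates their sum.\<close>

definition sep :: "nat \<Rightarrow> real" where
  "sep m = (case m of 0 \<Rightarrow> 0 | Suc p \<Rightarrow> sqrt (ratio p * ratio (Suc p)))"

lemma ratio_pos: "ratio k > 0"
  unfolding ratio_def by (intro divide_pos_pos pos)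

lemma ratio_growth: "4 * ratio k < ratio (Suc k)"
  using hutchinson[of k] pos[of k] pos[of "Suc k"] pos[of "Suc (Suc k)"]
  by (simp add: ratio_def field_simps power2_eq_square)

lemma ratio_mono: "j \<le> k \<Longrightarrow> ratio j \<le> ratio k"
proof (rule lift_Suc_mono_le)
  show "ratio n \<le> ratio (Suc n)" for n
    using ratio_growth[of n] ratio_pos[of n] by linarith
qed

lemma sep_Suc_sq: "sep (Suc p) ^ 2 = ratio p * ratio (Suc p)"
  using ratio_pos[of p] ratio_pos[of "Suc p"] by (simp add: sep_def)

lemma sep_Suc_pos: "sep (Suc p) > 0"
  by (simp add: sep_def ratio_pos)

text \<open>A geometric mean lies between its two factors. This makes the terms at
  \<open>- sep (Suc p)\<close> grow up to index \<open>p\<close> and shrink from index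
  \<open>p + 2\<close> on.\<close>

lemma ratio_le_sep: "ratio p \<le> sep (Suc p)"
  and sep_le_ratio: "sep (Suc p) \<le> ratio (Suc p)"
proof -
  have le: "ratio p \<le> ratio (Suc p)"
    by (simp add: ratio_mono)
  have "ratio p ^ 2 \<le> sep (Suc p) ^ 2"
    unfolding sep_Suc_sq using le ratio_pos[of p] by (simp add: power2_eq_square)
  then show "ratio p \<le> sep (Suc p)"
    by (rule power2_le_imp_le) (rule less_imp_le[OF sep_Suc_pos])
  have "sep (Suc p) ^ 2 \<le> ratio (Suc p) ^ 2"
    unfolding sep_Suc_sq using le ratio_pos[of "Suc p"] by (simp add: power2_eq_square)
  then show "sep (Suc p) \<le> ratio (Suc p)"
    by (rule power2_le_imp_le) (rule less_imp_le[OF ratio_pos])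
qed

lemma sep_strict_mono: "strict_mono sep"
  unfolding strict_mono_Suc_iff
proof
  fix m
  show "sep m < sep (Suc m)"
  proof (cases m)
    case 0
    then show ?thesis using sep_Suc_pos[of 0] by (simp add: sep_def)
  next
    case (Suc p)
    have "ratio p < ratio (Suc (Suc p))"
      using ratio_growth[of p] ratio_pos[of p] ratio_mono[of "Suc p" "Suc (Suc p)"] by simp
    then have "ratio p * ratio (Suc p) < ratio (Suc p) * ratio (Suc (Suc p))"
      using ratio_pos[of "Suc p"] by simp
    then show ?thesis by (simp add: Suc sep_def)
  qed
qed

lemma sep_nonneg: "sep m \<ge> 0"
  by (cases m) (auto simp: sep_def intro!: mult_nonneg_nonneg less_imp_le[OF ratio_pos])

section \<open>Signs of the partial sums at the separating points\<close>

definition partial_sum :: "nat \<Rightarrow> real \<Rightarrow> real" where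
  "partial_sum n x = (\<Sum>k\<le>n. c k * x ^ k)"

lemma continuous_on_partial_sum: "continuous_on A (partial_sum n)"
  unfolding partial_sum_def by (intro continuous_intros)

lemma partial_sum_pos: "x \<ge> 0 \<Longrightarrow> partial_sum n x > 0"
  unfolding partial_sum_def
  by (rule sum_pos2[of _ 0]) (auto intro!: mult_nonneg_nonneg pos less_imp_le[OF pos])

lemma partial_sum_sign:
  assumes "m \<le> n"
  shows "(-1) ^ m * partial_sum n (- sep m) > 0"
proof (cases m)
  case 0
  then show ?thesis by (simp add: sep_def partial_sum_pos)
next
  case (Suc p)
  define x where "x = sep (Suc p)"
  define t where "t k = c k * x ^ k" for k
  have x: "x > 0" by (simp add: x_def sep_Suc_pos)
  have t_pos: "t k > 0" for k by (simp add: t_def pos x)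
  have t_ratio: "t k = (ratio k / x) * t (Suc k)" for k
    using x pos[of k] pos[of "Suc k"] by (simp add: t_def ratio_def)
  have inc: "t k \<le> t (Suc k)" if "k < p" for k
  proof -
    have "ratio k / x \<le> 1"
      using ratio_mono[of k p] that ratio_le_sep[of p] x by (simp add: x_def)
    then show ?thesis
      using t_ratio[of k] t_pos[of "Suc k"] mult_right_mono[of "ratio k / x" 1 "t (Suc k)"] by simp
  qed
  have dec: "t (Suc k) \<le> t k" if "Suc p < k" for k
  proof -
    have "1 \<le> ratio k / x"
      using ratio_mono[of "Suc p" k] that sep_le_ratio[of p] x by (simp add: x_def)
    then show ?thesis
      using t_ratio[of k] t_pos[of "Suc k"] mult_right_mono[of 1 "ratio k / x" "t (Suc k)"] by simp
  qed
  have dom: "t p + t (p + 2) < t (Suc p)"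
  proof -
    have xx: "x * x = ratio p * ratio (Suc p)"
      using sep_Suc_sq[of p] by (simp add: x_def power2_eq_square)
    have "t (p + 2) = (x / ratio (Suc p)) * t (Suc p)"
      using t_ratio[of "Suc p"] x ratio_pos[of "Suc p"] by (simp add: field_simps)
    also have "x / ratio (Suc p) = ratio p / x"
      using xx x ratio_pos[of "Suc p"] by (simp add: field_simps)
    finally have eq: "t p + t (p + 2) = (2 * ratio p / x) * t (Suc p)"
      using t_ratio[of p] by (simp add: algebra_simps)
    \<comment> \<open>Both neighbours equal \<open>ratio p / x\<close> times the middle term. The
      constant 4 of the condition is the square of the 2 that arises from adding them.\<close>
    have "(2 * ratio p) ^ 2 < x ^ 2"
      using ratio_growth[of p] ratio_pos[of p] xx by (simp add: power2_eq_square)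
    then have "2 * ratio p < x"
      using x by (intro power_less_imp_less_base[of "2 * ratio p" 2 x]) auto
    then show ?thesis
      unfolding eq using x t_pos[of "Suc p"] mult_strict_right_mono[of "2 * ratio p / x" 1 "t (Suc p)"] by simp
  qed
  have "partial_sum n (- sep m) = (\<Sum>k\<le>n. (-1) ^ k * t k)"
    unfolding partial_sum_def t_def x_def Suc by (intro sum.cong) (simp_all add: power_minus[of "sep (Suc p)"])
  moreover have "(-1) ^ Suc p * (\<Sum>k\<le>n. (-1) ^ k * t k) > 0"
    by (rule alternating_sum_dominant_term) (use inc dec dom assms Suc in \<open>auto intro: less_imp_le[OF t_pos]\<close>)
  ultimately show ?thesis by (simp add: Suc)
qed

end

section \<open>Real zeros from sign changes\<close>

lemma zero_between_sign_change:
  fixes f :: "real \<Rightarrow> real"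
  assumes "continuous_on {u..v} f" "u \<le> v" "f u * f v \<le> 0"
  shows "\<exists>x\<in>{u..v}. f x = 0"
proof (cases "f u \<le> 0")
  case True
  then have "f u = 0 \<or> 0 \<le> f v"
    using assms(3) by (auto simp: mult_le_0_iff)
  then show ?thesis
    using IVT'[of f u 0 v] assms True by force
next
  case False
  then have "f v \<le> 0"
    using assms(3) by (auto simp: mult_le_0_iff)
  then show ?thesis
    using IVT2'[of f v 0 u] assms False by auto
qed

text \<open>The sign conditions are weak so that the lemma also serves the limit function, whose
  values at the separating points may vanish.\<close>

lemma zero_between_alternating_signs:
  fixes f :: "real \<Rightarrow> real"
  assumes "continuous_on {u..v} f" "u \<le> v"
    and "0 \<le> (-1) ^ m * f v" "0 \<le> (-1) ^ Suc m * f u"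
  shows "\<exists>x\<in>{u..v}. f x = 0"
proof (rule zero_between_sign_change)
  show "f u * f v \<le> 0"
    using assms(3,4) by (cases "even m") (auto simp: mult_le_0_iff)
qed (use assms in auto)

context Hutchinson_sequence
begin

text \<open>The \<open>n + 1\<close> points \<open>- sep 0\<close>, ..., \<open>- sep n\<close>
  carry alternating signs and bound \<open>n\<close> intervals, each with a zero. A nonzero
  polynomial of degree \<open>n\<close> has no room for further zeros in the complex plane.\<close>

lemma partial_sum_complex_roots:
  fixes z :: complex
  assumes "(\<Sum>k\<le>n. of_real (c k) * z ^ k) = 0"
  shows "z \<in> \<real>\<^sub>\<le>\<^sub>0"
proof -
  define Z where "Z = {z :: complex. (\<Sum>k\<le>n. of_real (c k) * z ^ k) = 0}"
  have Z: "finite Z" "card Z \<le> n"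
    using polyfun_rootbound[of n "\<lambda>k. of_real (c k) :: complex"] pos[of 0]
    unfolding Z_def by force+
  have "\<exists>x\<in>{- sep (Suc m)..- sep m}. partial_sum n x = 0" if "m < n" for m
    using that partial_sum_sign[of m n] partial_sum_sign[of "Suc m" n] strict_monoD[OF sep_strict_mono, of m "Suc m"]
    by (intro zero_between_alternating_signs[where m = m] continuous_on_partial_sum) auto
  then obtain w where w: "\<And>m. m < n \<Longrightarrow> - sep (Suc m) \<le> w m" "\<And>m. m < n \<Longrightarrow> w m \<le> - sep m"
      "\<And>m. m < n \<Longrightarrow> partial_sum n (w m) = 0"
    by (metis atLeastAtMost_iff)
  have w_less: "w k < w m" if "m < k" "k < n" for m k
  proof -
    \<comment> \<open>Neighbouring intervals share an endpoint. The strict sign there prevents one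
      zero from being counted twice.\<close>
    have "w m \<noteq> - sep (Suc m)"
      using w(3)[of m] partial_sum_sign[of "Suc m" n] that by auto
    then have "- sep (Suc m) < w m"
      using w(1)[of m] that by simp
    moreover have "sep (Suc m) \<le> sep k"
      using that sep_strict_mono by (simp add: strict_mono_less_eq)
    ultimately show ?thesis
      using w(2)[of k] that by linarith
  qed
  have inj: "inj_on w {..<n}"
    using w_less by (intro linorder_inj_onI) force+
  let ?W = "(\<lambda>m. complex_of_real (w m)) ` {..<n}"
  have "card ?W = n"
    using inj by (subst card_image) (auto simp: inj_on_def)
  moreover have "?W \<subseteq> Z"
    using w(3) by (auto simp: Z_def partial_sum_def simp flip: of_real_power of_real_mult of_real_sum)
  ultimately have "?W = Z"
    using Z by (metis card_seteq)
  then obtain m where "m < n" "z = of_real (w m)"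
    using assms unfolding Z_def by blast
  then show ?thesis
    using w(2)[of m] sep_nonneg[of m] by simp
qed

section \<open>Passage from the partial sums to the entire function\<close>

lemma power_series_nonconstant:
  assumes "summable (\<lambda>n. c n * 1 ^ n)" "summable (\<lambda>n. c n * 2 ^ n)"
  shows "(\<Sum>n. c n * 1 ^ n) < (\<Sum>n. c n * 2 ^ n)"
proof -
  have "0 < (\<Sum>n. c n * 2 ^ n - c n * 1 ^ n)"
  proof (rule suminf_pos2[where i = 1])
    show "summable (\<lambda>n. c n * 2 ^ n - c n * 1 ^ n)"
      by (intro summable_diff assms)
    show "0 \<le> c n * 2 ^ n - c n * 1 ^ n" for n
      using pos[of n] by simp
    show "0 < c 1 * 2 ^ 1 - c 1 * 1 ^ 1"
      using pos[of 1] by simp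
  qed
  then show ?thesis
    unfolding suminf_diff[OF assms(2,1), symmetric] by simp
qed

theorem Hutchinson_zeros:
  assumes entire: "\<And>z::complex. summable (\<lambda>n. of_real (c n) * z ^ n)"
  defines "F \<equiv> \<lambda>z::complex. \<Sum>n. of_real (c n) * z ^ n"
  shows "infinite {z. F z = 0}" and "F z = 0 \<Longrightarrow> z \<in> \<real> \<and> Re z < 0"
proof -
  define f where "f x = (\<Sum>n. c n * x ^ n)" for x :: real
  have summable_real: "summable (\<lambda>n. c n * x ^ n)" for x
    using entire[of "of_real x"] by (simp flip: of_real_power of_real_mult add: summable_complex_of_real)
  have F_of_real: "F (of_real x) = of_real (f x)" for x
    unfolding F_def f_def using suminf_of_real[OF summable_real[of x], where ?'a = complex] by simp
  have F0: "F 0 \<noteq> 0"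
    using pos[of 0] by (simp add: F_def)
  have lim: "(\<lambda>n. partial_sum n x) \<longlonglongrightarrow> f x" for x
    unfolding partial_sum_def f_def by (rule summable_LIMSEQ'[OF summable_real])
  have sign: "0 \<le> (-1) ^ m * f (- sep m)" for m
  proof (rule LIMSEQ_le_const)
    show "(\<lambda>n. (-1) ^ m * partial_sum n (- sep m)) \<longlonglongrightarrow> (-1) ^ m * f (- sep m)"
      by (intro tendsto_mult_left lim)
    show "\<exists>N. \<forall>n\<ge>N. 0 \<le> (-1) ^ m * partial_sum n (- sep m)"
      using partial_sum_sign[of m] less_imp_le by blast
  qed
  have "isCont f x" for x
    unfolding f_def
    by (rule DERIV_isCont[OF termdiffs_strong_converges_everywhere[OF summable_real]])
  then have "continuous_on A f" for A
    by (simp add: continuous_at_imp_continuous_on)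
  then have "\<exists>x\<in>{- sep (Suc m)..- sep m}. f x = 0" for m
    using sign[of m] sign[of "Suc m"] strict_monoD[OF sep_strict_mono, of m "Suc m"]
    by (intro zero_between_alternating_signs[where m = m]) auto
  then obtain w where w: "\<And>m. - sep (Suc m) \<le> w m" "\<And>m. w m \<le> - sep m" "\<And>m. f (w m) = 0"
    by (metis atLeastAtMost_iff)
  \<comment> \<open>The closed intervals may share endpoints, so only every other zero is used.\<close>
  have "w (2 * k) < w (2 * m)" if "m < k" for m k
  proof -
    have "sep (Suc (2 * m)) < sep (2 * k)"
      using that by (intro strict_monoD[OF sep_strict_mono]) simp
    then show ?thesis using w(1)[of "2 * m"] w(2)[of "2 * k"] by linarith
  qed
  then have "inj (\<lambda>m. complex_of_real (w (2 * m)))"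
    by (intro linorder_injI) force
  then have "infinite (range (\<lambda>m. complex_of_real (w (2 * m))))"
    by (rule range_inj_infinite)
  moreover have "range (\<lambda>m. complex_of_real (w (2 * m))) \<subseteq> {z. F z = 0}"
    using w(3) by (auto simp: F_of_real)
  ultimately show "infinite {z. F z = 0}"
    using finite_subset by blast

  \<comment> \<open>Removing the closed ray makes the domain open, but leaves the origin undecided;
    \<open>F0\<close> excludes it at the end.\<close>
  define S where "S = - (\<real>\<^sub>\<le>\<^sub>0 :: complex set)"
  have S: "open S" "connected S"
  proof -
    show "open S" by (simp add: S_def open_Compl)
    have "(\<real>\<^sub>\<le>\<^sub>0 :: complex set) = of_real ` {..0}"
      by (auto simp: nonpos_Reals_def)
    then show "connected S"
      unfolding S_def using starlike_imp_connected[OF starlike_slotted_complex_plane_left, of 0] by simp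
  qed
  have radius: "conv_radius (\<lambda>n. complex_of_real (c n)) = \<infinity>"
    by (rule conv_radius_inftyI'[where c = 0])
       (use entire in \<open>metis abs_of_pos norm_of_real\<close>)
  have nonzero: "F z \<noteq> 0" if "z \<in> S" for z
  proof (rule Hurwitz_no_zeros[OF S, of "\<lambda>n z. \<Sum>k\<le>n. of_real (c k) * z ^ k" F])
    show "(\<lambda>z. \<Sum>k\<le>n. of_real (c k) * z ^ k) holomorphic_on S" for n
      by (intro holomorphic_intros)
    have "(F has_field_derivative (\<Sum>n. diffs (\<lambda>n. of_real (c n)) n * z ^ n)) (at z)" for z
      unfolding F_def by (rule termdiffs_strong_converges_everywhere[OF entire])
    then show "F holomorphic_on S"
      by (meson holomorphic_on_open S(1))
    show "uniform_limit K (\<lambda>n z. \<Sum>k\<le>n. of_real (c k) * z ^ k) F sequentially"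
      if K: "compact K" for K
    proof -
      obtain R where R: "K \<subseteq> cball 0 R"
        using compact_imp_bounded[OF K] by (meson ball_subset_cball bounded_subset_ballD order_trans)
      have "uniform_limit (cball 0 R) (\<lambda>n z. \<Sum>k<n. of_real (c k) * z ^ k) F sequentially"
        using powser_uniform_limit[of R "\<lambda>n. complex_of_real (c n)" 0] radius by (simp add: F_def)
      then have "uniform_limit K (\<lambda>n z. \<Sum>k<n. of_real (c k) * z ^ k) F sequentially"
        using R uniform_limit_on_subset by blast
      \<comment> \<open>The shift turns sums over \<open>k < n\<close> into sums up to and including
        \<open>n\<close>.\<close>
      from filterlim_compose[OF this filterlim_Suc] show ?thesis
        by (simp add: lessThan_Suc_atMost)
    qed
    show "\<not> F constant_on S"
    proof
      assume "F constant_on S"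
      \<comment> \<open>Any two positive reals would do: positive coefficients make the series
        strictly increasing there.\<close>
      moreover have "1 \<in> S" "2 \<in> S"
        by (auto simp: S_def complex_nonpos_Reals_iff)
      ultimately have "F (of_real 1) = F (of_real 2)"
        unfolding constant_on_def by force
      then have "f 1 = f 2"
        by (simp only: F_of_real of_real_eq_iff)
      then show False
        using power_series_nonconstant[OF summable_real summable_real] by (simp add: f_def)
    qed
    show "(\<Sum>k\<le>n. of_real (c k) * z ^ k) \<noteq> 0" if "z \<in> S" for n z
      using that partial_sum_complex_roots[of z n] by (auto simp: S_def)
  qed (use that in auto)
  show "z \<in> \<real> \<and> Re z < 0" if "F z = 0"
  proof -
    have "z \<in> \<real>\<^sub>\<le>\<^sub>0"
      using nonzero[of z] that by (auto simp: S_def)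
    moreover have "z \<noteq> 0"
      using that F0 by auto
    ultimately show ?thesis
      by (auto simp: complex_nonpos_Reals_iff complex_is_Real_iff complex_eq_iff less_le)
  qed
qed

end

section \<open>The tails of the series\<close>

lemma hyp_coeff_pos:
  assumes "\<And>j. 1 \<le> j \<Longrightarrow> j \<le> r \<Longrightarrow> a j > 0" "\<And>j. 1 \<le> j \<Longrightarrow> j \<le> s \<Longrightarrow> b j > 0" "0 < q"
  shows "hyp_coeff r s a b \<alpha> q k > 0"
  unfolding hyp_coeff_def using assms
  by (intro mult_pos_pos divide_pos_pos prod_pos) (auto intro!: pochhammer_pos)

lemma tendsto_prod_shift_quotient:
  fixes d :: "nat \<Rightarrow> real"
  shows "(\<lambda>k. (\<Prod>j=1..m. d j + real (Suc k)) / (\<Prod>j=1..m. d j + real k)) \<longlonglongrightarrow> 1"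
proof -
  have "(\<lambda>k. (d j + real (Suc k)) / (d j + real k)) \<longlonglongrightarrow> 1" for j
    by real_asymp
  then have "(\<lambda>k. \<Prod>j=1..m. (d j + real (Suc k)) / (d j + real k)) \<longlonglongrightarrow> (\<Prod>j=1..m. 1)"
    by (intro tendsto_prod)
  then show ?thesis
    by (simp add: prod_dividef)
qed

text \<open>With \<open>R k\<close> the quotient of consecutive coefficients, the condition says
  \<open>R (Suc k) / R k < 1/4\<close>. The Pochhammer factors contribute a limit of 1 to this
  quotient and the Gaussian factor contributes \<open>(q powr \<alpha>) ^ 2\<close>, which is below
  1/4.\<close>

lemma eventually_hyp_coeff_hutchinson:
  assumes a: "\<And>j. 1 \<le> j \<Longrightarrow> j \<le> r \<Longrightarrow> a j > 0" and b: "\<And>j. 1 \<le> j \<Longrightarrow> j \<le> s \<Longrightarrow> b j > 0"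
    and q: "0 < q" "q powr \<alpha> < 1 / 2"
  shows "\<forall>\<^sub>F k in sequentially.
    4 * hyp_coeff r s a b \<alpha> q k * hyp_coeff r s a b \<alpha> q (k + 2) < hyp_coeff r s a b \<alpha> q (Suc k) ^ 2"
proof -
  let ?h = "hyp_coeff r s a b \<alpha> q"
  let ?A = "\<lambda>k. \<Prod>j=1..r. a j + real k" and ?B = "\<lambda>k. \<Prod>j=1..s. b j + real k"
  define R where "R k = ?A k / ?B k * q powr (\<alpha> * (2 * real k + 1))" for k
  have h_Suc: "?h (Suc k) = ?h k * R k" for k
    by (simp add: hyp_coeff_Suc R_def)
  have h_pos: "?h k > 0" for k
    by (rule hyp_coeff_pos) (use a b q in auto)
  have R_pos: "R k > 0" for k
    using h_Suc[of k] h_pos[of k] h_pos[of "Suc k"] by (simp add: zero_less_mult_iff)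
  have quotient: "R (Suc k) / R k = (?A (Suc k) / ?A k) / (?B (Suc k) / ?B k) * (q powr \<alpha>) ^ 2" for k
  proof -
    have "\<alpha> * (2 * real (Suc k) + 1) = \<alpha> * (2 * real k + 1) + 2 * \<alpha>"
      by (simp add: algebra_simps)
    moreover have "q powr (2 * \<alpha>) = (q powr \<alpha>) ^ 2"
      by (simp add: powr_powr powr_numeral flip: powr_add mult_2 add: power2_eq_square)
    ultimately show ?thesis
      using q by (simp only: R_def powr_add) (simp add: mult_ac)
  qed
  have "(\<lambda>k. R (Suc k) / R k) \<longlonglongrightarrow> 1 / 1 * (q powr \<alpha>) ^ 2"
    unfolding quotient by (intro tendsto_intros tendsto_prod_shift_quotient) simp
  moreover have "(q powr \<alpha>) ^ 2 < (1 / 2) ^ 2"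
    using q by (intro power_strict_mono) auto
  ultimately have "\<forall>\<^sub>F k in sequentially. R (Suc k) / R k < 1 / 4"
    by (intro order_tendstoD(2)) (auto simp: power2_eq_square)
  then show ?thesis
  proof eventually_elim
    case (elim k)
    then have "4 * R (Suc k) < R k"
      using R_pos[of k] by (simp add: field_simps)
    \<comment> \<open>The multiplier is chosen so that the two sides become
      \<open>4 * ?h k * ?h (k + 2)\<close> and \<open>?h (Suc k) ^ 2\<close>.\<close>
    then have "?h k ^ 2 * R k * (4 * R (Suc k)) < ?h k ^ 2 * R k * R k"
      using h_pos[of k] R_pos[of k] by simp
    then show ?case
      by (simp add: h_Suc power2_eq_square mult_ac)
  qed
qed

lemma summable_shifted_hyp_coeff:
  fixes z :: complex
  assumes "\<And>j. 1 \<le> j \<Longrightarrow> j \<le> s \<Longrightarrow> b j > 0" "\<alpha> > 0" "0 < q" "q < 1"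
  shows "summable (\<lambda>n. of_real (hyp_coeff r s a b \<alpha> q (n + K)) * z ^ n)"
proof (cases "z = 0")
  case False
  have "summable (\<lambda>n. of_real (hyp_coeff r s a b \<alpha> q (n + K)) * z ^ (n + K))"
    by (rule summable_hyp_tail) (use assms in auto)
  then have "summable (\<lambda>n. of_real (hyp_coeff r s a b \<alpha> q (n + K)) * z ^ (n + K) / z ^ K)"
    by (rule summable_divide)
  then show ?thesis
    using False by (simp add: power_add)
next
  case True
  then show ?thesis
    using summable_finite[of "{0}" "\<lambda>n. of_real (hyp_coeff r s a b \<alpha> q (n + K)) * z ^ n"]
    by simp
qed

theorem theorem1p3:
  fixes r s :: nat and a b :: "nat \<Rightarrow> real" and \<alpha> q :: real
  assumes "r \<ge> 1" and "s \<ge> 1"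
    and "\<And>j. 1 \<le> j \<Longrightarrow> j \<le> r \<Longrightarrow> a j > 0"
    and "\<And>k. 1 \<le> k \<Longrightarrow> k \<le> s \<Longrightarrow> b k > 0"
    and "\<alpha> > 0" and "0 < q" and "q < 2 powr (- (1 / \<alpha>))"
  shows "\<exists>K0::nat. K0 \<ge> 1 \<and> (\<forall>K\<ge>K0.
           only_infinitely_many_real_zeros (hyp_tail r s a b \<alpha> q K) \<and>
           (\<forall>z. hyp_tail r s a b \<alpha> q K z = 0 \<and> z \<noteq> 0 \<longrightarrow> Re z < 0))"
proof -
  let ?h = "hyp_coeff r s a b \<alpha> q"
  have "q powr \<alpha> < (2 powr (- (1 / \<alpha>))) powr \<alpha>"
    using assms(5-7) by (intro powr_less_mono2) auto
  also have "\<dots> = 1 / 2"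
    using assms(5) by (simp only: powr_powr) (simp add: powr_minus_divide)
  finally have q_half: "q powr \<alpha> < 1 / 2" .
  have "q < 1"
  proof (rule ccontr)
    assume "\<not> q < 1"
    then have "q powr \<alpha> \<ge> 1"
      using assms(5) by (simp add: ge_one_powr_ge_zero)
    then show False using q_half by simp
  qed
  obtain N where N: "\<And>k. k \<ge> N \<Longrightarrow> 4 * ?h k * ?h (k + 2) < ?h (Suc k) ^ 2"
    using eventually_hyp_coeff_hutchinson[OF _ _ assms(6) q_half, of r a s b] assms(3,4)
    unfolding eventually_sequentially by blast
  show ?thesis
  proof (intro exI[of _ "max N 1"] conjI allI impI)
    fix K assume K: "max N 1 \<le> K"
    define F where "F z = (\<Sum>n. complex_of_real (?h (n + K)) * z ^ n)" for z
    have sm: "summable (\<lambda>n. complex_of_real (?h (n + K)) * z ^ n)" for z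
      by (rule summable_shifted_hyp_coeff) (use assms \<open>q < 1\<close> in auto)
    interpret Hutchinson_sequence "\<lambda>n. ?h (n + K)"
    proof
      show "0 < ?h (n + K)" for n
        by (rule hyp_coeff_pos) (use assms in auto)
      show "4 * ?h (n + K) * ?h (n + 2 + K) < ?h (Suc n + K) ^ 2" for n
        using N[of "n + K"] K by (simp add: add_ac)
    qed
    \<comment> \<open>The extra factor can add only the zero at the origin, which is real; all other
      zeros are those of \<open>F\<close>.\<close>
    have tail: "hyp_tail r s a b \<alpha> q K z = F z * z ^ K" for z
      unfolding hyp_tail_def F_def
      using suminf_mult2[OF sm[of z], of "z ^ K"] by (simp add: power_add mult_ac)
    note zeros = Hutchinson_zeros[OF sm, folded F_def]
    have "infinite {z. hyp_tail r s a b \<alpha> q K z = 0}"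
      using zeros(1) by (rule infinite_super[rotated]) (auto simp: tail)
    moreover have "z \<in> \<real>" if "hyp_tail r s a b \<alpha> q K z = 0" for z
      using that zeros(2)[of z] by (auto simp: tail)
    ultimately show "only_infinitely_many_real_zeros (hyp_tail r s a b \<alpha> q K)"
      by (simp add: only_infinitely_many_real_zeros_def)
    show "Re z < 0" if "hyp_tail r s a b \<alpha> q K z = 0 \<and> z \<noteq> 0" for z
      using that zeros(2)[of z] by (auto simp: tail)
  qed simp
qed

end
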